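(* For every $d\ge5$ there exist a bounded open set $\Omega\subset\mathbb R^d$ with smooth boundary, a non-convex compact set of controls $U\subset\mathbb R^2$, a smooth controlled vector field $f$, a time $T>0$, a point $\mathbf x_0\in\Omega$, positive numbers $\delta,\varepsilon>0$, and a curve $\gamma\in\mathcal S^{\mathrm r}_{\overline\Omega}(\mathbf x_0)\setminus\mathcal S_{\overline\Omega}(\mathbf x_0)$ such that, for all $x\in\mathbb R^d$ with $\|x-\mathbf x_0\|\le\delta$ and all $\theta\in\mathcal S_{\overline\Omega}(x)$, $$\|\gamma-\theta\|_\infty\ge\varepsilon.$$
   Context: Smooth means $C^\infty$. A controlled vector field is a map $f:\mathbb R\times\mathbb R^d\times U\to\mathbb R^d$, $(t,x,u)\mapsto f(t,x,u)$. For $x\in\mathbb R^d$: - $\mathcal S_{\overline\Omega}(x)$ is the set of absolutely continuous curves $\gamma:[0,T]\to\overline\Omega$ with $\gamma(0)=x$ and $\gamma'(t)\in\{f(t,\gamma(t),u):u\in U\}$ for a.e. $t\in[0,T]$. - $\mathcal S^{\mathrm r}_{\overline\Omega}(x)$ is the set of absolutely continuous curves $\gamma:[0,T]\to\overline\Omega$ with $\gamma(0)=x$ and $\gamma'(t)\in\operatorname{conv}\{f(t,\gamma(t),u):u\in U\}$ for a.e. $t\in[0,T]$. These sets are empty if $x\notin\overline\Omega$. $\|\cdot\|_\infty$ is the supremum norm on $[0,T]$. *)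

theory Defs
  imports "HOL-Analysis.Analysis"
begin

text \<open>
  Class \<open>C\<^sup>k\<close> on an open set \<open>S\<close>. The recursion runs over directional derivatives, because the
  type of the derivative itself changes with its order. In finite dimension, differentiability
  together with continuity of all directional derivatives is the usual notion.
\<close>

primrec Ck_on :: "nat \<Rightarrow> 'a::euclidean_space set \<Rightarrow> ('a \<Rightarrow> 'b::euclidean_space) \<Rightarrow> bool" where
  "Ck_on 0 S f \<longleftrightarrow> continuous_on S f"
| "Ck_on (Suc k) S f \<longleftrightarrow>
     (\<forall>x\<in>S. f differentiable (at x)) \<and> (\<forall>v. Ck_on k S (\<lambda>x. frechet_derivative f (at x) v))"

text \<open>
  On a set that need not be open, smooth means that there is a smooth extension to an open
  neighbourhood. For open \<open>S\<close> this is smoothness in the ordinary sense.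
\<close>

definition smooth_on :: "'a::euclidean_space set \<Rightarrow> ('a \<Rightarrow> 'b::euclidean_space) \<Rightarrow> bool" where
  "smooth_on S f \<longleftrightarrow>
     (\<exists>W g. open W \<and> S \<subseteq> W \<and> (\<forall>x\<in>S. g x = f x) \<and> (\<forall>k. Ck_on k W g))"

text \<open>
  Near each boundary point the set is the strict sublevel set of a smooth function without
  critical points. It therefore lies on one side of its boundary, and \<open>frontier \<Omega> \<inter> V\<close> is the zero
  set of \<open>g\<close> in \<open>V\<close>.
\<close>

definition smooth_boundary :: "'a::euclidean_space set \<Rightarrow> bool" where
  "smooth_boundary \<Omega> \<longleftrightarrow>
     (\<forall>p\<in>frontier \<Omega>. \<exists>V (g::'a \<Rightarrow> real). open V \<and> p \<in> V \<and> smooth_on V g \<and>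
        (\<forall>x\<in>V. frechet_derivative g (at x) \<noteq> (\<lambda>_. 0)) \<and>
        \<Omega> \<inter> V = {x\<in>V. g x < 0})"

text \<open>
  The members of a division are finitely many compact intervals \<open>k = {Inf k..Sup k}\<close> with disjoint
  interiors.
\<close>

definition abs_continuous_on :: "real set \<Rightarrow> (real \<Rightarrow> 'a::real_normed_vector) \<Rightarrow> bool" where
  "abs_continuous_on I \<gamma> \<longleftrightarrow>
     (\<forall>e>0. \<exists>d>0. \<forall>\<D> J. \<D> division_of J \<and> J \<subseteq> I \<and> (\<Sum>k\<in>\<D>. Sup k - Inf k) < d
        \<longrightarrow> (\<Sum>k\<in>\<D>. norm (\<gamma> (Sup k) - \<gamma> (Inf k))) < e)"

text \<open>
  A curve on \<open>{0..T}\<close> is represented by a total function of which only the values on \<open>{0..T}\<close>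
  matter, hence the derivative within \<open>{0..T}\<close>.
\<close>

definition trajectories ::
    "(real \<Rightarrow> 'a \<Rightarrow> 'a set) \<Rightarrow> 'a::euclidean_space set \<Rightarrow> real \<Rightarrow> 'a \<Rightarrow> (real \<Rightarrow> 'a) set" where
  "trajectories F K T x =
     {\<gamma>. abs_continuous_on {0..T} \<gamma> \<and> \<gamma> ` {0..T} \<subseteq> K \<and> \<gamma> 0 = x \<and>
         (AE t in lebesgue. t \<in> {0..T} \<longrightarrow>
            (\<exists>v\<in>F t (\<gamma> t). (\<gamma> has_vector_derivative v) (at t within {0..T})))}"

definition controlled_trajectories ::
    "(real \<Rightarrow> 'a \<Rightarrow> 'u \<Rightarrow> 'a) \<Rightarrow> 'u set \<Rightarrow> 'a::euclidean_space set \<Rightarrow> real \<Rightarrow> 'a \<Rightarrow> (real \<Rightarrow> 'a) set" where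
  "controlled_trajectories f U \<Omega> T x =
     trajectories (\<lambda>t y. {f t y u |u. u \<in> U}) (closure \<Omega>) T x"

definition relaxed_trajectories ::
    "(real \<Rightarrow> 'a \<Rightarrow> 'u \<Rightarrow> 'a) \<Rightarrow> 'u set \<Rightarrow> 'a::euclidean_space set \<Rightarrow> real \<Rightarrow> 'a \<Rightarrow> (real \<Rightarrow> 'a) set" where
  "relaxed_trajectories f U \<Omega> T x =
     trajectories (\<lambda>t y. convex hull {f t y u |u. u \<in> U}) (closure \<Omega>) T x"

text \<open>
  Supremum norm on \<open>{0..T}\<close>. \<open>Sup\<close> on the reals is meaningful only for nonempty bounded sets, as is
  the case for \<open>T \<ge> 0\<close> and \<open>\<gamma>\<close> continuous on \<open>{0..T}\<close>.
\<close>

definition sup_norm :: "real \<Rightarrow> (real \<Rightarrow> 'a::real_normed_vector) \<Rightarrow> real" where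
  "sup_norm T \<gamma> = (SUP t\<in>{0..T}. norm (\<gamma> t))"

end

theory Submission
  imports Defs
begin

text \<open>
  Let \<open>p\<close>, \<open>q\<close> be orthonormal. On the unit ball take the field \<open>u p + ((x \<bullet> p)\<^sup>2 - cos t) q\<close> with
  \<open>u = \<plusminus>1\<close>. The relaxed control \<open>u = 0\<close> gives the curve \<open>- sin t q\<close>, which touches the sphere at
  \<open>- q\<close> at time \<open>\<pi>/2\<close> and at \<open>q\<close> at time \<open>3\<pi>/2\<close>. Along any curve \<open>\<theta>\<close> with controls \<open>\<plusminus>1\<close> the function
  \<open>\<theta> \<bullet> q + sin t\<close> has derivative \<open>(\<theta> \<bullet> p)\<^sup>2 \<ge> 0\<close>, while staying in the closed ball makes it nonnegative
  at \<open>\<pi>/2\<close> and nonpositive at \<open>3\<pi>/2\<close>. So \<open>\<theta> \<bullet> p = 0\<close> in between, although its derivative is \<open>\<plusminus>1\<close>.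
  Hence no controlled trajectory exists at all, from any initial point, and the lower bound on the
  distance holds vacuously.
\<close>

section \<open>Closure properties of the classes C^k\<close>

lemma Ck_on_cong:
  assumes "open S" "\<And>x. x \<in> S \<Longrightarrow> f x = g x" "Ck_on k S f"
  shows "Ck_on k S g"
  using assms(2,3)
proof (induction k arbitrary: f g)
  case 0
  then show ?case
    using continuous_on_cong by fastforce
next
  case (Suc k)
  have d: "f differentiable (at x)" if "x \<in> S" for x
    using Suc.prems that by simp
  have d': "g differentiable (at x)" if "x \<in> S" for x
    using d[OF that] Suc.prems(1) that \<open>open S\<close>
    by (meson differentiable_def has_derivative_transform_within_open)
  have "frechet_derivative f (at x) = frechet_derivative g (at x)" if "x \<in> S" for x
    by (rule frechet_derivative_transform_within_open[OF d[OF that] \<open>open S\<close> that])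
       (use Suc.prems in auto)
  then show ?case
    using Suc.IH[of "\<lambda>x. frechet_derivative f (at x) v" "\<lambda>x. frechet_derivative g (at x) v" for v]
      Suc.prems d' by simp
qed

text \<open>Replaces \<open>frechet_derivative\<close> by any explicit formula for the derivative,
  so that the closure lemmas below can be fed directly with the rules of differentiation.\<close>

lemma Ck_on_SucI:
  assumes "open S" "\<And>x. x \<in> S \<Longrightarrow> (f has_derivative f' x) (at x)"
    and "\<And>v. Ck_on k S (\<lambda>x. f' x v)"
  shows "Ck_on (Suc k) S f"
proof -
  have "f' x = frechet_derivative f (at x)" if "x \<in> S" for x
    using assms(2)[OF that] by (rule frechet_derivative_at)
  then have "Ck_on k S (\<lambda>x. frechet_derivative f (at x) v)" for v
    by (intro Ck_on_cong[OF assms(1) _ assms(3)[of v]]) simp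
  moreover have "f differentiable (at x)" if "x \<in> S" for x
    using assms(2)[OF that] by (auto simp: differentiable_def)
  ultimately show ?thesis by simp
qed

lemma Ck_on_SucD:
  assumes "Ck_on (Suc k) S f"
  shows "Ck_on k S f"
  using assms
proof (induction k arbitrary: f)
  case 0
  then show ?case
    by (auto intro!: continuous_at_imp_continuous_on differentiable_imp_continuous_within)
qed simp

lemma Ck_on_has_derivative:
  assumes "Ck_on (Suc k) S f" "x \<in> S"
  shows "(f has_derivative frechet_derivative f (at x)) (at x)"
  using assms by (simp add: frechet_derivative_works)

lemma Ck_on_const [intro]: "open S \<Longrightarrow> Ck_on k S (\<lambda>x. c)"
proof (induction k arbitrary: c)
  case (Suc k)
  show ?case
    by (rule Ck_on_SucI[OF Suc.prems has_derivative_const Suc.IH[OF Suc.prems]])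
qed simp

lemma Ck_on_bounded_linear:
  assumes "open S" "bounded_linear f"
  shows "Ck_on k S f"
proof (cases k)
  case 0
  then show ?thesis
    using assms by (simp add: linear_continuous_on)
next
  case (Suc m)
  show ?thesis
    unfolding Suc
    by (rule Ck_on_SucI[OF assms(1) bounded_linear_imp_has_derivative[OF assms(2)] Ck_on_const[OF assms(1)]])
qed

lemma Ck_on_add:
  assumes "open S" "Ck_on k S f" "Ck_on k S g"
  shows "Ck_on k S (\<lambda>x. f x + g x)"
  using assms(2,3)
proof (induction k arbitrary: f g)
  case 0
  then show ?case by (auto intro: continuous_on_add)
next
  case (Suc k)
  show ?case
    by (rule Ck_on_SucI[OF assms(1) has_derivative_add[OF Ck_on_has_derivative[OF Suc.prems(1)]
          Ck_on_has_derivative[OF Suc.prems(2)]]])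
       (use Suc in auto)
qed

text \<open>One product rule for \<open>inner\<close>, \<open>scaleR\<close> and real multiplication
  alike. The derivative of the product is a sum of products of one factor with a derivative of the
  other; the undifferentiated factor is one order smoother than needed, and
  \<open>Ck_on_SucD\<close> lowers it to order \<open>k\<close> for the induction.\<close>

lemma Ck_on_bilinear:
  fixes prod :: "'a::euclidean_space \<Rightarrow> 'b::euclidean_space \<Rightarrow> 'c::euclidean_space"
  assumes "open S" "bounded_bilinear prod" "Ck_on k S f" "Ck_on k S g"
  shows "Ck_on k S (\<lambda>x. prod (f x) (g x))"
  using assms(3,4)
proof (induction k arbitrary: f g)
  case 0
  then show ?case
    using bounded_bilinear.continuous_on[OF assms(2)] by simp
next
  case (Suc k)
  show ?case
    by (rule Ck_on_SucI[OF assms(1) bounded_bilinear.FDERIV[OF assms(2) Ck_on_has_derivative[OF Suc.prems(1)]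
          Ck_on_has_derivative[OF Suc.prems(2)]]])
       (use Suc.prems Ck_on_SucD[OF Suc.prems(1)] Ck_on_SucD[OF Suc.prems(2)]
          in \<open>auto intro!: Ck_on_add[OF assms(1)] Suc.IH\<close>)
qed

text \<open>Differentiation swaps the two functions, so a single induction has to carry both. The
  derivatives are written with \<open>scaleR\<close> so that \<open>Ck_on_bilinear\<close> applies
  to them.\<close>

lemma Ck_on_cos_sin:
  fixes f :: "'a::euclidean_space \<Rightarrow> real"
  assumes "open S" "bounded_linear f"
  shows "Ck_on k S (\<lambda>x. cos (f x)) \<and> Ck_on k S (\<lambda>x. sin (f x))"
proof (induction k)
  case 0
  show ?case
    using linear_continuous_on[OF assms(2)] by (simp add: continuous_on_cos continuous_on_sin)
next
  case (Suc k)
  have f: "(f has_derivative f) (at x)" for x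
    by (rule bounded_linear_imp_has_derivative[OF assms(2)])
  have "((\<lambda>x. cos (f x)) has_derivative (\<lambda>v. sin (f x) *\<^sub>R (- f v))) (at x)"
       "((\<lambda>x. sin (f x)) has_derivative (\<lambda>v. cos (f x) *\<^sub>R f v)) (at x)" for x
    by (auto intro!: derivative_eq_intros f)
  then show ?case
    using Suc.IH
    by (intro conjI Ck_on_SucI[OF assms(1), of _ "\<lambda>x v. sin (f x) *\<^sub>R (- f v)"]
        Ck_on_SucI[OF assms(1), of _ "\<lambda>x v. cos (f x) *\<^sub>R f v"]
        Ck_on_bilinear[OF assms(1) bounded_bilinear_scaleR] Ck_on_const[OF assms(1)]) auto
qed


text \<open>The defining function is \<open>x \<bullet> x - 1\<close>. Its gradient
  \<open>2 x\<close> vanishes only at the origin, which is not on the sphere, so the complement of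
  the origin serves as \<open>V\<close> for every boundary point.\<close>

lemma smooth_boundary_ball: "smooth_boundary (ball (0::'a::euclidean_space) 1)"
  unfolding smooth_boundary_def
proof
  fix p :: 'a assume p: "p \<in> frontier (ball 0 1)"
  define g where "g = (\<lambda>x::'a. x \<bullet> x + - 1)"
  have g': "frechet_derivative g (at x) = (\<lambda>v. 2 * (x \<bullet> v))" for x
    by (rule frechet_derivative_at[symmetric])
       (auto simp: g_def inner_commute intro!: derivative_eq_intros)
  have "Ck_on k UNIV g" for k
    unfolding g_def
    by (intro Ck_on_add Ck_on_bilinear[OF _ bounded_bilinear_inner] Ck_on_const
        Ck_on_bounded_linear bounded_linear_ident open_UNIV)
  then have "smooth_on (- {0}) g"
    by (auto simp: smooth_on_def intro!: exI[of _ UNIV])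
  moreover have "frechet_derivative g (at x) \<noteq> (\<lambda>_. 0)" if "x \<noteq> 0" for x
    using that by (auto simp: g' dest!: fun_cong[of _ _ x])
  moreover have "ball 0 1 \<inter> - {0} = {x \<in> - {0}. g x < 0}"
    by (auto simp: g_def norm_lt_square)
  moreover have "p \<in> - {0}" using p by auto
  ultimately show "\<exists>V (g::'a \<Rightarrow> real). open V \<and> p \<in> V \<and> smooth_on V g \<and>
      (\<forall>x\<in>V. frechet_derivative g (at x) \<noteq> (\<lambda>_. 0)) \<and> ball 0 1 \<inter> V = {x\<in>V. g x < 0}"
    by (intro exI[of _ "- {0}"] exI[of _ g]) (auto simp del: Int_iff)
qed

section \<open>Absolutely continuous functions\<close>

lemma abs_continuous_on_subset:
  "\<lbrakk>abs_continuous_on I g; J \<subseteq> I\<rbrakk> \<Longrightarrow> abs_continuous_on J g"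
  unfolding abs_continuous_on_def by (meson order_trans)

lemma division_of_intervalE:
  fixes J :: "real set"
  assumes "\<D> division_of J" "k \<in> \<D>"
  obtains "Inf k \<in> J" "Sup k \<in> J" "Inf k \<le> Sup k"
proof -
  obtain u v where "k = {u..v}" "k \<noteq> {}" "k \<subseteq> J"
    using division_ofD(2-4)[OF assms] by (metis box_real(2))
  moreover from this have "u \<in> J" "v \<in> J" by auto
  ultimately show ?thesis using that by auto
qed

lemma lipschitz_on_imp_abs_continuous_on:
  assumes "C-lipschitz_on I g"
  shows "abs_continuous_on I g"
  unfolding abs_continuous_on_def
proof (intro allI impI)
  fix e :: real assume "e > 0"
  have C: "C \<ge> 0" using assms by (rule lipschitz_on_nonneg)
  show "\<exists>d>0. \<forall>\<D> J. \<D> division_of J \<and> J \<subseteq> I \<and> (\<Sum>k\<in>\<D>. Sup k - Inf k) < d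
        \<longrightarrow> (\<Sum>k\<in>\<D>. norm (g (Sup k) - g (Inf k))) < e"
  \<comment> \<open>\<open>C + 1\<close> in place of \<open>C\<close> keeps the denominator positive
    when \<open>C = 0\<close>.\<close>
  proof (intro exI[of _ "e / (C + 1)"] conjI allI impI)
    show "e / (C + 1) > 0" using C \<open>e > 0\<close> by simp
    fix \<D> J assume "\<D> division_of J \<and> J \<subseteq> I \<and> (\<Sum>k\<in>\<D>. Sup k - Inf k) < e / (C + 1)"
    then have D: "\<D> division_of J" "J \<subseteq> I" "(\<Sum>k\<in>\<D>. Sup k - Inf k) < e / (C + 1)" by auto
    have "(\<Sum>k\<in>\<D>. norm (g (Sup k) - g (Inf k))) \<le> (\<Sum>k\<in>\<D>. (C + 1) * (Sup k - Inf k))"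
    proof (rule sum_mono)
      fix k assume "k \<in> \<D>"
      then have k: "Inf k \<in> I" "Sup k \<in> I" "Inf k \<le> Sup k"
        using D(1,2) by (meson division_of_intervalE subsetD)+
      then have "norm (g (Sup k) - g (Inf k)) \<le> C * (Sup k - Inf k)"
        using lipschitz_onD[OF assms k(2,1)] by (simp add: dist_norm)
      also have "\<dots> \<le> (C + 1) * (Sup k - Inf k)"
        using k by (intro mult_right_mono) auto
      finally show "norm (g (Sup k) - g (Inf k)) \<le> (C + 1) * (Sup k - Inf k)" .
    qed
    also have "\<dots> < e"
      using D(3) C by (simp add: pos_less_divide_eq mult.commute flip: sum_distrib_left)
    finally show "(\<Sum>k\<in>\<D>. norm (g (Sup k) - g (Inf k))) < e" .
  qed
qed

lemma abs_continuous_on_add: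
  assumes "abs_continuous_on I f" "abs_continuous_on I g"
  shows "abs_continuous_on I (\<lambda>t. f t + g t)"
  unfolding abs_continuous_on_def
proof (intro allI impI)
  fix e :: real assume "e > 0"
  then have "e / 2 > 0" by simp
  obtain d1 where d1: "d1 > 0"
    "\<And>\<D> J. \<lbrakk>\<D> division_of J; J \<subseteq> I; (\<Sum>k\<in>\<D>. Sup k - Inf k) < d1\<rbrakk>
        \<Longrightarrow> (\<Sum>k\<in>\<D>. norm (f (Sup k) - f (Inf k))) < e / 2"
    using assms(1) \<open>e / 2 > 0\<close> unfolding abs_continuous_on_def by meson
  obtain d2 where d2: "d2 > 0"
    "\<And>\<D> J. \<lbrakk>\<D> division_of J; J \<subseteq> I; (\<Sum>k\<in>\<D>. Sup k - Inf k) < d2\<rbrakk>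
        \<Longrightarrow> (\<Sum>k\<in>\<D>. norm (g (Sup k) - g (Inf k))) < e / 2"
    using assms(2) \<open>e / 2 > 0\<close> unfolding abs_continuous_on_def by meson
  show "\<exists>d>0. \<forall>\<D> J. \<D> division_of J \<and> J \<subseteq> I \<and> (\<Sum>k\<in>\<D>. Sup k - Inf k) < d
        \<longrightarrow> (\<Sum>k\<in>\<D>. norm (f (Sup k) + g (Sup k) - (f (Inf k) + g (Inf k)))) < e"
  proof (intro exI[of _ "min d1 d2"] conjI allI impI)
    fix \<D> J assume "\<D> division_of J \<and> J \<subseteq> I \<and> (\<Sum>k\<in>\<D>. Sup k - Inf k) < min d1 d2"
    then have D: "\<D> division_of J" "J \<subseteq> I" "(\<Sum>k\<in>\<D>. Sup k - Inf k) < min d1 d2" by auto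
    have "(\<Sum>k\<in>\<D>. norm (f (Sup k) + g (Sup k) - (f (Inf k) + g (Inf k))))
        \<le> (\<Sum>k\<in>\<D>. norm (f (Sup k) - f (Inf k)) + norm (g (Sup k) - g (Inf k)))"
      by (intro sum_mono norm_diff_triangle_ineq)
    also have "\<dots> < e"
      using d1(2)[OF D(1,2)] d2(2)[OF D(1,2)] D(3) by (simp add: sum.distrib)
    finally show "(\<Sum>k\<in>\<D>. norm (f (Sup k) + g (Sup k) - (f (Inf k) + g (Inf k)))) < e" .
  qed (use d1 d2 in auto)
qed

lemma abs_continuous_on_bounded_linear:
  assumes "bounded_linear h" "abs_continuous_on I f"
  shows "abs_continuous_on I (\<lambda>t. h (f t))"
  unfolding abs_continuous_on_def
proof (intro allI impI)
  fix e :: real assume "e > 0"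
  obtain K where "K > 0" and K: "\<And>x. norm (h x) \<le> norm x * K"
    using bounded_linear.pos_bounded[OF assms(1)] by blast
  then have "e / K > 0" using \<open>e > 0\<close> by simp
  then obtain d where "d > 0" and d:
    "\<And>\<D> J. \<lbrakk>\<D> division_of J; J \<subseteq> I; (\<Sum>k\<in>\<D>. Sup k - Inf k) < d\<rbrakk>
        \<Longrightarrow> (\<Sum>k\<in>\<D>. norm (f (Sup k) - f (Inf k))) < e / K"
    using assms(2) unfolding abs_continuous_on_def by meson
  show "\<exists>d>0. \<forall>\<D> J. \<D> division_of J \<and> J \<subseteq> I \<and> (\<Sum>k\<in>\<D>. Sup k - Inf k) < d
        \<longrightarrow> (\<Sum>k\<in>\<D>. norm (h (f (Sup k)) - h (f (Inf k)))) < e"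
  proof (intro exI[of _ d] conjI allI impI)
    fix \<D> J assume "\<D> division_of J \<and> J \<subseteq> I \<and> (\<Sum>k\<in>\<D>. Sup k - Inf k) < d"
    then have D: "\<D> division_of J" "J \<subseteq> I" "(\<Sum>k\<in>\<D>. Sup k - Inf k) < d" by auto
    have "(\<Sum>k\<in>\<D>. norm (h (f (Sup k)) - h (f (Inf k)))) \<le> (\<Sum>k\<in>\<D>. norm (f (Sup k) - f (Inf k)) * K)"
      using K by (intro sum_mono) (simp flip: linear_diff[OF bounded_linear.linear[OF assms(1)]])
    also have "\<dots> < e"
      using d[OF D] \<open>K > 0\<close> by (simp add: pos_less_divide_eq flip: sum_distrib_right)
    finally show "(\<Sum>k\<in>\<D>. norm (h (f (Sup k)) - h (f (Inf k)))) < e" .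
  qed (fact \<open>d > 0\<close>)
qed

lemma abs_continuous_on_sin: "abs_continuous_on I (sin :: real \<Rightarrow> real)"
proof (rule lipschitz_on_imp_abs_continuous_on[of 1], rule lipschitz_onI)
  show "dist (sin x) (sin y) \<le> 1 * dist x y" for x y :: real
    using field_differentiable_bound[of UNIV sin cos 1 x y]
    by (auto simp: dist_norm norm_minus_commute intro!: derivative_eq_intros)
qed simp

text \<open>A gauge argument. On a fine tagged division, intervals with tag outside \<open>N\<close>
  lose at most \<open>e\<close> times their length, by differentiability at the tag; intervals with
  tag in \<open>N\<close> have small total length, so absolute continuity bounds their total loss by
  \<open>e\<close>.\<close>

lemma abs_continuous_on_nondecreasing:
  fixes g :: "real \<Rightarrow> real"
  assumes "a \<le> b" and ac: "abs_continuous_on {a..b} g" and N: "negligible N"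
    and deriv: "\<And>t. t \<in> {a..b} - N \<Longrightarrow> \<exists>v\<ge>0. (g has_vector_derivative v) (at t within {a..b})"
  shows "g a \<le> g b"
proof -
  have main: "g a - g b \<le> e * (1 + (b - a))" if "e > 0" for e
  proof -
    obtain d where "d > 0" and d: "\<And>\<D> J. \<lbrakk>\<D> division_of J; J \<subseteq> {a..b}; (\<Sum>k\<in>\<D>. Sup k - Inf k) < d\<rbrakk>
        \<Longrightarrow> (\<Sum>k\<in>\<D>. norm (g (Sup k) - g (Inf k))) < e"
      using ac \<open>e > 0\<close> unfolding abs_continuous_on_def by meson
    \<comment> \<open>The Henstock-Kurzweil integral of the indicator supplies a gauge for which the
      intervals tagged in \<open>N\<close> have total length below \<open>d\<close>.\<close>
    have "(indicator N has_integral (0::real)) (cbox a b)"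
      using N by (auto simp: negligible_def)
    then obtain G where "gauge G" and G: "\<And>p. \<lbrakk>p tagged_division_of cbox a b; G fine p\<rbrakk>
        \<Longrightarrow> norm ((\<Sum>(x,k)\<in>p. measure lborel k *\<^sub>R indicator N x) - (0::real)) < d"
      using \<open>d > 0\<close> unfolding has_integral by meson
    \<comment> \<open>Straddle estimate: both endpoints are compared with the tag \<open>t\<close>
      between them. The linear terms have the favourable sign because \<open>v \<ge> 0\<close>, so
      only the two error terms remain. For other \<open>t\<close> the radius 1 is arbitrary; the
      gauge just has to be defined everywhere.\<close>
    have "\<exists>r>0. t \<in> {a..b} - N \<longrightarrow> (\<forall>u v. a \<le> u \<and> u \<le> t \<and> t \<le> v \<and> v \<le> b \<and> {u..v} \<subseteq> ball t r
        \<longrightarrow> g u - g v \<le> e * (v - u))" for t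
    proof (cases "t \<in> {a..b} - N")
      case True
      then obtain v where "v \<ge> 0" and "(g has_vector_derivative v) (at t within {a..b})"
        using deriv by blast
      then obtain r where "r > 0" and
        r: "\<And>s. \<lbrakk>s \<in> {a..b}; norm (s - t) < r\<rbrakk> \<Longrightarrow> norm (g s - g t - (s - t) *\<^sub>R v) \<le> e * norm (s - t)"
        using \<open>e > 0\<close> unfolding has_vector_derivative_def has_derivative_within_alt by meson
      have "g x - g y \<le> e * (y - x)" if "a \<le> x" "x \<le> t" "t \<le> y" "y \<le> b" "{x..y} \<subseteq> ball t r" for x y
      proof -
        have "x \<in> ball t r" "y \<in> ball t r"
          using that by (auto simp del: mem_ball)
        then have "\<bar>g x - g t - (x - t) * v\<bar> \<le> e * (t - x)" "\<bar>g y - g t - (y - t) * v\<bar> \<le> e * (y - t)"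
          using r[of x] r[of y] that by (auto simp: dist_real_def)
        moreover have "(x - t) * v \<le> 0" "0 \<le> (y - t) * v"
          using that \<open>v \<ge> 0\<close> by (auto simp: mult_nonpos_nonneg)
        ultimately show ?thesis by (simp add: algebra_simps)
      qed
      with \<open>r > 0\<close> show ?thesis by auto
    qed (auto intro: exI[of _ 1])
    then obtain r where "\<And>t. r t > 0" and r: "\<And>t u v. \<lbrakk>t \<in> {a..b} - N; a \<le> u; u \<le> t; t \<le> v; v \<le> b;
        {u..v} \<subseteq> ball t (r t)\<rbrakk> \<Longrightarrow> g u - g v \<le> e * (v - u)"
      by metis
    then have "gauge (\<lambda>t. G t \<inter> ball t (r t))"
      using \<open>gauge G\<close> by (intro gauge_Int gauge_ball_dependent) auto
    then obtain p where p: "p tagged_division_of {a..b}" and "(\<lambda>t. G t \<inter> ball t (r t)) fine p"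
      by (rule fine_division_exists_real)
    then have fine: "G fine p" "(\<lambda>t. ball t (r t)) fine p"
      by (auto simp: fine_Int)
    have fin: "finite p" using p by blast
    have tag: "\<exists>u v. k = {u..v} \<and> a \<le> u \<and> u \<le> x \<and> x \<le> v \<and> v \<le> b" if xk: "(x,k) \<in> p" for x k
    proof -
      obtain u v where "k = cbox u v" "x \<in> k" "k \<subseteq> {a..b}"
        using tagged_division_ofD(2-4)[OF p xk] by metis
      then show ?thesis by (intro exI[of _ u] exI[of _ v]) auto
    qed
    define q where "q = {(x,k) \<in> p. x \<in> N}"
    have "q \<subseteq> p" by (auto simp: q_def)
    then have q: "q tagged_partial_division_of {a..b}"
      using p tagged_partial_division_subset unfolding tagged_division_of_def by metis
    note q' = tagged_partial_division_of_Union_self[OF q]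
    have tag_q: "\<exists>u v. k = {u..v} \<and> a \<le> u \<and> u \<le> x \<and> x \<le> v \<and> v \<le> b \<and> x \<in> N"
      if "(x,k) \<in> q" for x k
      using tag[of x k] that by (auto simp: q_def)
    \<comment> \<open>Absolute continuity speaks of sets of intervals, while \<open>q\<close>
      consists of tagged ones. An interval can occur with two tags only if it is degenerate, and
      there \<open>h\<close> vanishes. The library lemma also asks for the value 0 on the empty
      interval, where \<open>Inf\<close> and \<open>Sup\<close> say nothing, hence the detour
      through \<open>if\<close>.\<close>
    have over: "(\<Sum>k\<in>snd ` q. h (Sup k) (Inf k)) = (\<Sum>(x,k)\<in>q. h (Sup k) (Inf k))"
      if h: "\<And>u. h u u = 0" for h :: "real \<Rightarrow> real \<Rightarrow> real"
    proof -
      have ne: "k \<noteq> {}" if "(x,k) \<in> q" for x k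
        using tag_q[OF that] by auto
      have "(\<Sum>k\<in>snd ` q. h (Sup k) (Inf k)) = (\<Sum>k\<in>snd ` q. if k = {} then 0 else h (Sup k) (Inf k))"
        using ne by (intro sum.cong) auto
      also have "\<dots> = (\<Sum>(x,k)\<in>q. if k = {} then 0 else h (Sup k) (Inf k))"
      proof (rule sum.over_tagged_division_lemma[OF q', symmetric])
        fix u v :: real assume "box u v = {}"
        then have "cbox u v = {} \<or> u = v" by auto
        then show "(if cbox u v = {} then 0 else h (Sup (cbox u v)) (Inf (cbox u v))) = 0"
          by (auto simp: h)
      qed
      also have "\<dots> = (\<Sum>(x,k)\<in>q. h (Sup k) (Inf k))"
        using ne by (intro sum.cong) auto
      finally show ?thesis .
    qed
    have "(\<Sum>(x,k)\<in>q. Sup k - Inf k) = (\<Sum>(x,k)\<in>p. measure lborel k * indicator N x)"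
    proof (rule sum.mono_neutral_cong_left[OF fin \<open>q \<subseteq> p\<close>])
      show "\<forall>i\<in>p - q. (case i of (x, k) \<Rightarrow> measure lborel k * indicator N x) = 0"
        by (auto simp: q_def indicator_def)
      show "(case i of (x, k) \<Rightarrow> Sup k - Inf k) = (case i of (x, k) \<Rightarrow> measure lborel k * indicator N x)"
        if "i \<in> q" for i
        using tag_q[of "fst i" "snd i"] that by (cases i) auto
    qed
    also have "\<dots> < d" using G[of p] p fine by simp
    finally have "(\<Sum>k\<in>snd ` q. Sup k - Inf k) < d"
      using over[of "\<lambda>u v. u - v"] by simp
    moreover have "\<Union> (snd ` q) \<subseteq> {a..b}"
      using tag_q by fastforce
    ultimately have "(\<Sum>k\<in>snd ` q. norm (g (Sup k) - g (Inf k))) < e"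
      by (intro d[OF partial_division_of_tagged_division[OF q]])
    then have A: "(\<Sum>(x,k)\<in>q. norm (g (Sup k) - g (Inf k))) < e"
      using over[of "\<lambda>u v. norm (g u - g v)"] by simp
    \<comment> \<open>The increments telescope over the whole division; they are then split
      according to whether the tag lies in \<open>N\<close>.\<close>
    have "g a - g b = (\<Sum>(x,k)\<in>p. g (Inf k) - g (Sup k))"
      using additive_tagged_division_1[OF \<open>a \<le> b\<close> p, of g]
      by (simp add: case_prod_unfold sum_subtractf)
    also have "\<dots> \<le> (\<Sum>(x,k)\<in>p. (if x \<in> N then norm (g (Sup k) - g (Inf k)) else 0) + e * (Sup k - Inf k))"
    proof (rule sum_mono, clarify)
      fix x k assume xk: "(x,k) \<in> p"
      then obtain u v where uv: "k = {u..v}" "a \<le> u" "u \<le> x" "x \<le> v" "v \<le> b" using tag by meson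
      have "x \<notin> N \<Longrightarrow> g u - g v \<le> e * (v - u)"
        using uv fineD[OF fine(2) xk] by (intro r[of x]) auto
      then show "g (Inf k) - g (Sup k) \<le> (if x \<in> N then norm (g (Sup k) - g (Inf k)) else 0) + e * (Sup k - Inf k)"
        using uv \<open>e > 0\<close> by (auto simp: intro: add_increasing2)
    qed
    also have "\<dots> = (\<Sum>(x,k)\<in>q. norm (g (Sup k) - g (Inf k))) + e * (\<Sum>(x,k)\<in>p. Sup k - Inf k)"
    proof -
      have "(\<Sum>(x,k)\<in>p. if x \<in> N then norm (g (Sup k) - g (Inf k)) else 0)
          = (\<Sum>(x,k)\<in>q. norm (g (Sup k) - g (Inf k)))"
        by (rule sum.mono_neutral_cong_right[OF fin \<open>q \<subseteq> p\<close>])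
          (auto simp: q_def split: if_splits)
      then show ?thesis
        by (simp add: case_prod_unfold sum.distrib sum_distrib_left)
    qed
    also have "(\<Sum>(x,k)\<in>p. Sup k - Inf k) = b - a"
      using additive_tagged_division_1[OF \<open>a \<le> b\<close> p, of "\<lambda>x. x"] by simp
    finally show ?thesis using A by (simp add: algebra_simps)
  qed
  have "g a - g b \<le> 0"
  proof (rule field_le_epsilon)
    fix e :: real assume "e > 0"
    then show "g a - g b \<le> 0 + e"
      using main[of "e / (1 + (b - a))"] \<open>a \<le> b\<close> by simp
  qed
  then show ?thesis by simp
qed

section \<open>The control system and its relaxed trajectory\<close>

text \<open>The scalar controls 1 and -1, embedded in the plane as first coordinates.\<close>

definition ctrl :: "(real^2) set" where
  "ctrl = {axis 1 1, - axis 1 1}"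

text \<open>On the hyperplane orthogonal to \<open>p\<close> the speed along \<open>q\<close> is
  \<open>- cos t\<close>. The square turns any departure from this hyperplane, to either side, into
  extra speed in the direction \<open>q\<close>.\<close>

definition ctrl_field :: "'a::euclidean_space \<Rightarrow> 'a \<Rightarrow> real \<Rightarrow> 'a \<Rightarrow> real^2 \<Rightarrow> 'a" where
  "ctrl_field p q t x u = (u $ 1) *\<^sub>R p + ((x \<bullet> p)\<^sup>2 - cos t) *\<^sub>R q"

lemma not_convex_ctrl: "\<not> convex ctrl"
proof
  assume "convex ctrl"
  then have "(1/2) *\<^sub>R axis 1 1 + (1/2) *\<^sub>R (- axis 1 1) \<in> ctrl"
    by (rule convexD) (auto simp: ctrl_def)
  then show False
    by (auto simp: ctrl_def axis_eq_0_iff)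
qed

lemma smooth_on_ctrl_field:
  fixes p q :: "'a::euclidean_space"
  shows "smooth_on S (\<lambda>(t, x, u). ctrl_field p q t x u)"
proof -
  \<comment> \<open>The field rewritten with sums and products only, to match the closure lemmas; it
    is smooth on the whole space, so the extension can be taken on \<open>UNIV\<close>.\<close>
  define g :: "real \<times> 'a \<times> (real^2) \<Rightarrow> 'a" where
    "g = (\<lambda>z. (snd (snd z) $ 1) *\<^sub>R p + ((fst (snd z) \<bullet> p) * (fst (snd z) \<bullet> p) + - 1 * cos (fst z)) *\<^sub>R q)"
  have u: "Ck_on k UNIV (\<lambda>z :: real \<times> 'a \<times> (real^2). snd (snd z) $ 1)" for k
    by (intro Ck_on_bounded_linear open_UNIV bounded_linear_compose[OF bounded_linear_vec_nth]
        bounded_linear_compose[OF bounded_linear_snd] bounded_linear_snd)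
  have x: "Ck_on k UNIV (\<lambda>z :: real \<times> 'a \<times> (real^2). fst (snd z) \<bullet> p)" for k
    by (intro Ck_on_bounded_linear open_UNIV bounded_linear_compose[OF bounded_linear_inner_left]
        bounded_linear_compose[OF bounded_linear_fst] bounded_linear_snd)
  have c: "Ck_on k UNIV (\<lambda>z :: real \<times> 'a \<times> (real^2). cos (fst z))" for k
    using Ck_on_cos_sin[OF open_UNIV bounded_linear_fst] by blast
  have "Ck_on k UNIV g" for k
    unfolding g_def
    by (intro Ck_on_add[OF open_UNIV] Ck_on_bilinear[OF open_UNIV bounded_bilinear_scaleR]
        Ck_on_bilinear[OF open_UNIV bounded_bilinear_mult] Ck_on_const[OF open_UNIV] u x c)
  moreover have "g z = (case z of (t, x, u) \<Rightarrow> ctrl_field p q t x u)" for z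
    by (cases z) (simp add: g_def ctrl_field_def power2_eq_square)
  ultimately show ?thesis
    unfolding smooth_on_def by (intro exI[of _ UNIV] exI[of _ g]) simp
qed

lemma relaxed_trajectory:
  fixes p q :: "'a::euclidean_space"
  assumes "norm q = 1" "p \<bullet> q = 0"
  shows "(\<lambda>t. - sin t *\<^sub>R q) \<in> relaxed_trajectories (ctrl_field p q) ctrl (ball 0 1) T 0"
proof -
  have "abs_continuous_on {0..T} (\<lambda>t. (- sin t) *\<^sub>R q)"
    using abs_continuous_on_bounded_linear[OF bounded_linear_scaleR_left abs_continuous_on_sin, of "{0..T}" "- q"]
    by simp
  moreover have "- cos t *\<^sub>R q \<in> convex hull {ctrl_field p q t (- sin t *\<^sub>R q) u |u. u \<in> ctrl}" for t
  proof -
    have *: "ctrl_field p q t (- sin t *\<^sub>R q) u \<in> convex hull {ctrl_field p q t (- sin t *\<^sub>R q) u |u. u \<in> ctrl}"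
      if "u \<in> ctrl" for u
      using that by (intro hull_inc) auto
    \<comment> \<open>Equal weights on the two controls cancel the component along \<open>p\<close>.
      The curve is orthogonal to \<open>p\<close>, so the square vanishes as well and exactly the
      velocity of the curve is left.\<close>
    have "(1/2) *\<^sub>R ctrl_field p q t (- sin t *\<^sub>R q) (axis 1 1) + (1/2) *\<^sub>R ctrl_field p q t (- sin t *\<^sub>R q) (- axis 1 1)
       \<in> convex hull {ctrl_field p q t (- sin t *\<^sub>R q) u |u. u \<in> ctrl}"
      by (rule convexD[OF convex_convex_hull * *]) (auto simp: ctrl_def)
    also have "(1/2) *\<^sub>R ctrl_field p q t (- sin t *\<^sub>R q) (axis 1 1) + (1/2) *\<^sub>R ctrl_field p q t (- sin t *\<^sub>R q) (- axis 1 1)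
        = - cos t *\<^sub>R q"
      using assms(2) by (simp add: ctrl_field_def inner_commute algebra_simps flip: scaleR_left_distrib)
    finally show ?thesis .
  qed
  moreover have "((\<lambda>t. - sin t *\<^sub>R q) has_vector_derivative - cos t *\<^sub>R q) (at t within {0..T})" for t
    by (auto intro!: derivative_eq_intros)
  ultimately show ?thesis
    using assms(1) unfolding relaxed_trajectories_def trajectories_def
    by (auto intro!: AE_I2)
qed

section \<open>Nonexistence of controlled trajectories\<close>

lemma no_controlled_trajectory:
  fixes p q :: "'a::euclidean_space"
  assumes "norm p = 1" "norm q = 1" "p \<bullet> q = 0"
  shows "controlled_trajectories (ctrl_field p q) ctrl (ball 0 1) (2 * pi) x = {}"
proof (rule equals0I)
  fix \<theta> assume "\<theta> \<in> controlled_trajectories (ctrl_field p q) ctrl (ball 0 1) (2 * pi) x"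
  then have ac: "abs_continuous_on {0..2*pi} \<theta>" and in_ball: "\<theta> ` {0..2*pi} \<subseteq> cball 0 1"
    and ae: "AE t in lebesgue. t \<in> {0..2*pi} \<longrightarrow>
       (\<exists>v\<in>{ctrl_field p q t (\<theta> t) u |u. u \<in> ctrl}. (\<theta> has_vector_derivative v) (at t within {0..2*pi}))"
    unfolding controlled_trajectories_def trajectories_def by auto
  obtain N where "N \<in> null_sets lebesgue" and N: "\<And>t. \<lbrakk>t \<in> {0..2*pi}; t \<notin> N\<rbrakk> \<Longrightarrow>
       \<exists>u\<in>ctrl. (\<theta> has_vector_derivative ctrl_field p q t (\<theta> t) u) (at t within {0..2*pi})"
    using ae by (elim AE_E3) fastforce
  then have negl: "negligible N" by (simp add: negligible_iff_null_sets)
  define w where "w = (\<lambda>t. \<theta> t \<bullet> q + sin t)"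
  have pq: "p \<bullet> p = 1" "q \<bullet> q = 1" "q \<bullet> p = 0"
    using assms by (auto simp: norm_eq_1 inner_commute)
  have deriv: "(w has_vector_derivative (\<theta> t \<bullet> p)\<^sup>2) (at t within {0..2*pi}) \<and>
      (\<exists>c\<noteq>0. ((\<lambda>t. \<theta> t \<bullet> p) has_vector_derivative c) (at t within {0..2*pi}))"
    if t: "t \<in> {0..2*pi}" "t \<notin> N" for t
  proof -
    obtain u where u: "u \<in> ctrl" and
      d: "(\<theta> has_vector_derivative ctrl_field p q t (\<theta> t) u) (at t within {0..2*pi})"
      using N[OF t] by blast
    have d_inner: "((\<lambda>t. \<theta> t \<bullet> b) has_vector_derivative ctrl_field p q t (\<theta> t) u \<bullet> b) (at t within {0..2*pi})" for b
      by (rule bounded_linear.has_vector_derivative[OF bounded_linear_inner_left d])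
    have "(sin has_vector_derivative cos t) (at t within {0..2*pi})"
      by (auto intro!: derivative_eq_intros simp flip: has_real_derivative_iff_has_vector_derivative)
    from has_vector_derivative_add[OF d_inner[of q] this]
    have "(w has_vector_derivative (\<theta> t \<bullet> p)\<^sup>2) (at t within {0..2*pi})"
      using pq assms by (simp add: w_def ctrl_field_def inner_add_left)
    \<comment> \<open>By orthonormality this inner product is the scalar control itself, 1 or
      -1.\<close>
    moreover have "ctrl_field p q t (\<theta> t) u \<bullet> p \<noteq> 0"
      using u pq by (auto simp: ctrl_field_def ctrl_def inner_add_left)
    ultimately show ?thesis using d_inner by blast
  qed
  have "abs_continuous_on {0..2*pi} w"
    unfolding w_def
    by (intro abs_continuous_on_add abs_continuous_on_sin
        abs_continuous_on_bounded_linear[OF bounded_linear_inner_left ac])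
  then have mono: "w s \<le> w t" if "0 \<le> s" "s \<le> t" "t \<le> 2 * pi" for s t
  proof (intro abs_continuous_on_nondecreasing[OF that(2) _ negl])
    fix r assume "r \<in> {s..t} - N"
    then show "\<exists>v\<ge>0. (w has_vector_derivative v) (at r within {s..t})"
      using that deriv[of r] by (intro exI[of _ "(\<theta> r \<bullet> p)\<^sup>2"])
        (auto intro: has_vector_derivative_within_subset[where S = "{0..2*pi}"])
  qed (use that in \<open>auto intro: abs_continuous_on_subset\<close>)
  have bound: "\<bar>\<theta> t \<bullet> q\<bar> \<le> 1" if "t \<in> {0..2*pi}" for t
    using in_ball that Cauchy_Schwarz_ineq2[of "\<theta> t" q] assms(2) by fastforce
  have "sin (3*pi/2) = - 1"
    using sin_3over2_pi by simp
  then have "w (pi/2) \<ge> 0" "w (3*pi/2) \<le> 0"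
    using bound[of "pi/2"] bound[of "3*pi/2"] by (auto simp: w_def)
  then have w0: "w t = 0" if "t \<in> {pi/2<..<3*pi/2}" for t
    using mono[of "pi/2" t] mono[of t "3*pi/2"] that by auto
  \<comment> \<open>At interior times the one-set derivative is the full one, for which uniqueness
    of derivatives is available.\<close>
  have at: "at t within {0..2*pi} = at t" if "t \<in> {pi/2<..<3*pi/2}" for t
    using that by (intro at_within_Icc_at) (auto intro: less_trans[of 0 "pi/2"])
  have zero: "\<theta> t \<bullet> p = 0" if "t \<in> {pi/2<..<3*pi/2}" "t \<notin> N" for t
  proof -
    have "((\<lambda>_. 0) has_vector_derivative (\<theta> t \<bullet> p)\<^sup>2) (at t)"
      using deriv[of t] that w0 at[of t]
      by (auto intro!: has_vector_derivative_transform_within_open[of w _ t "{pi/2<..<3*pi/2}"])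
    then show ?thesis
      using vector_derivative_unique_at[OF _ has_vector_derivative_const] by fastforce
  qed
  have "\<not> negligible {pi/2<..<3*pi/2}"
    by (intro open_not_negligible) auto
  then obtain t where t: "t \<in> {pi/2<..<3*pi/2}" "t \<notin> N"
    using negl negligible_subset by blast
  then obtain c where "c \<noteq> 0" and c: "((\<lambda>t. \<theta> t \<bullet> p) has_real_derivative c) (at t)"
    using deriv[of t] at[of t] by (auto simp: has_real_derivative_iff_has_vector_derivative)
  \<comment> \<open>Vanishing of \<open>\<theta> \<bullet> p\<close> is known only off
    \<open>N\<close>, so the contradiction is drawn locally. A nonzero derivative at
    \<open>t\<close> forces nonzero values at all nearby times other than \<open>t\<close>; these
    times would all lie in \<open>N\<close>, making a nonempty open set negligible.\<close>
  have "\<forall>\<^sub>F s in at t. (\<theta> s \<bullet> p - \<theta> t \<bullet> p) / (s - t) \<noteq> 0"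
    using c \<open>c \<noteq> 0\<close> unfolding has_field_derivative_iff by (rule tendsto_imp_eventually_ne)
  moreover have "\<forall>\<^sub>F s in at t. s \<in> {pi/2<..<3*pi/2}"
    using t by (intro eventually_at_in_open') auto
  ultimately have "\<forall>\<^sub>F s in at t. s \<in> N"
    by eventually_elim (use zero t in auto)
  then obtain S where "open S" "t \<in> S" "\<forall>s\<in>S. s \<noteq> t \<longrightarrow> s \<in> N"
    by (auto simp: eventually_at_topological)
  then have "S \<subseteq> insert t N" by auto
  then have "negligible S" using negl by (meson negligible_insert negligible_subset)
  then show False using open_not_negligible \<open>open S\<close> \<open>t \<in> S\<close> by blast
qed

theorem theorem5:
  assumes "CARD('d::finite) \<ge> 5"
  shows "\<exists>(\<Omega> :: (real^'d) set) (U :: (real^2) set) (f :: real \<Rightarrow> real^'d \<Rightarrow> real^2 \<Rightarrow> real^'d)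
            (T :: real) (x0 :: real^'d) (\<delta> :: real) (\<epsilon> :: real) (\<gamma> :: real \<Rightarrow> real^'d).
           open \<Omega> \<and> bounded \<Omega> \<and> smooth_boundary \<Omega> \<and>
           compact U \<and> \<not> convex U \<and>
           smooth_on (UNIV \<times> UNIV \<times> U) (\<lambda>(t, x, u). f t x u) \<and>
           T > 0 \<and> x0 \<in> \<Omega> \<and> \<delta> > 0 \<and> \<epsilon> > 0 \<and>
           \<gamma> \<in> relaxed_trajectories f U \<Omega> T x0 - controlled_trajectories f U \<Omega> T x0 \<and>
           (\<forall>x. norm (x - x0) \<le> \<delta> \<longrightarrow>
              (\<forall>\<theta>\<in>controlled_trajectories f U \<Omega> T x. sup_norm T (\<lambda>t. \<gamma> t - \<theta> t) \<ge> \<epsilon>))"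
proof -
  \<comment> \<open>Two different coordinates provide the orthonormal pair \<open>p\<close>,
    \<open>q\<close>.\<close>
  have "\<not> (\<forall>i j :: 'd. i = j)"
    using assms card_le_Suc0_iff_eq[of "UNIV :: 'd set"] by auto
  then obtain i j :: 'd where "i \<noteq> j" by blast
  define p q :: "real^'d" where "p = axis i 1" and "q = axis j 1"
  have pq: "norm p = 1" "norm q = 1" "p \<bullet> q = 0"
    using \<open>i \<noteq> j\<close> by (auto simp: p_def q_def inner_axis_axis)
  have no_traj: "controlled_trajectories (ctrl_field p q) ctrl (ball 0 1) (2 * pi) x = {}" for x
    by (rule no_controlled_trajectory[OF pq])
  show ?thesis
  proof (intro exI conjI)
    show "open (ball (0 :: real^'d) 1)" "bounded (ball (0 :: real^'d) 1)" "(0 :: real^'d) \<in> ball 0 1"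
      by auto
    show "smooth_boundary (ball (0 :: real^'d) 1)" by (rule smooth_boundary_ball)
    show "compact ctrl" by (simp add: ctrl_def)
    show "\<not> convex ctrl" by (rule not_convex_ctrl)
    show "smooth_on (UNIV \<times> UNIV \<times> ctrl) (\<lambda>(t, x, u). ctrl_field p q t x u)"
      by (rule smooth_on_ctrl_field)
    \<comment> \<open>The horizon \<open>2 * pi\<close> contains both contact times. The value 1 for
      the radius and for the gap is an arbitrary positive choice, since there is no controlled
      trajectory to compare with.\<close>
    show "2 * pi > 0" "(1 :: real) > 0" "(1 :: real) > 0" by auto
    show "(\<lambda>t. - sin t *\<^sub>R q) \<in> relaxed_trajectories (ctrl_field p q) ctrl (ball 0 1) (2 * pi) 0
        - controlled_trajectories (ctrl_field p q) ctrl (ball 0 1) (2 * pi) 0"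
      unfolding no_traj using relaxed_trajectory[OF pq(2,3)] by blast
    show "\<forall>x. norm (x - 0) \<le> 1 \<longrightarrow> (\<forall>\<theta>\<in>controlled_trajectories (ctrl_field p q) ctrl (ball 0 1) (2 * pi) x.
        sup_norm (2 * pi) (\<lambda>t. - sin t *\<^sub>R q - \<theta> t) \<ge> 1)"
      unfolding no_traj by blast
  qed
qed

end
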